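(* Let $M$ be a locally compact metric space with a continuous flow, and let $K\subseteq M$ be an isolated attractor. The following statements are equivalent: (1) $K$ has only internal explosions, i.e. $J^{+}(x)\subseteq K$ for all $x\in\mathcal{A}(K)-K$; (2) $J^{-}(x)\subseteq K$ for all $x\in\widehat{K}-K$. Moreover, in case any of these holds, $\widehat{K}=W^u(K)$.
   Context: A continuous flow is a continuous action $M\times\mathbb{R}\to M$, $(x,t)\mapsto x\cdot t$. $\omega(x)$ and $\alpha(x)$ are the usual limit sets. $J^{+}(x)=\bigcap_{U,\,t\ge 0}\overline{U\cdot[t,+\infty)}$ and $J^{-}(x)=\bigcap_{U,\,t\ge 0}\overline{U\cdot(-\infty,-t]}$, where $U$ ranges over the open neighbourhoods of $x$ in $M$. A compact invariant set $K$ is isolated if it has a compact neighbourhood $N$ such that $K=\{x\in N: x\cdot\mathbb{R}\subseteq N\}$. Put $W^s(K)=\{x\in M:\emptyset\ne\omega(x)\subseteq K\}$ and $W^u(K)=\{x\in M:\emptyset\neq\alpha(x)\subseteq K\}$. An isolated attractor is an isolated compact invariant set $K$ such that $W^s(K)$ is a neighbourhood of $K$; its basin of attraction is $\mathcal{A}(K)=W^s(K)$ (an open set). It is not required to be stable. $\widehat{K}=\bigcup_{x\in K}J^{+}(x)$ is the stabilization of $K$: the smallest stable attractor containing $K$, which satisfies $\mathcal{A}(\widehat K)=\mathcal{A}(K)$ (stable means having a neighbourhood basis of positively invariant sets). *)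

theory Defs
  imports "HOL-Analysis.Analysis"
begin

text \<open>A flow on a space \<open>M\<close> is a curried map \<open>\<phi>\<close> with \<open>\<phi> x t\<close> for \<open>x \<cdot> t\<close>; the phase space is the
  whole type, so \<open>closure\<close>, \<open>interior\<close> and \<open>open\<close> are taken in \<open>M\<close>.\<close>

definition continuous_flow :: "('a::topological_space \<Rightarrow> real \<Rightarrow> 'a) \<Rightarrow> bool" where
  "continuous_flow \<phi> \<longleftrightarrow>
     continuous_on UNIV (\<lambda>(x, t). \<phi> x t) \<and>
     (\<forall>x. \<phi> x 0 = x) \<and>
     (\<forall>x s t. \<phi> (\<phi> x s) t = \<phi> x (s + t))"

text \<open>\<open>A \<cdot> T\<close> for a set of points \<open>A\<close> and a set of times \<open>T\<close>.\<close>

definition flow_image :: "('a \<Rightarrow> real \<Rightarrow> 'a) \<Rightarrow> 'a set \<Rightarrow> real set \<Rightarrow> 'a set" where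
  "flow_image \<phi> A T = {\<phi> x t | x t. x \<in> A \<and> t \<in> T}"

definition invariant_set :: "('a \<Rightarrow> real \<Rightarrow> 'a) \<Rightarrow> 'a set \<Rightarrow> bool" where
  "invariant_set \<phi> A \<longleftrightarrow> flow_image \<phi> A UNIV = A"

definition omega_limit :: "('a::topological_space \<Rightarrow> real \<Rightarrow> 'a) \<Rightarrow> 'a \<Rightarrow> 'a set" where
  "omega_limit \<phi> x = (\<Inter>t\<in>{0..}. closure (flow_image \<phi> {x} {t..}))"

definition alpha_limit :: "('a::topological_space \<Rightarrow> real \<Rightarrow> 'a) \<Rightarrow> 'a \<Rightarrow> 'a set" where
  "alpha_limit \<phi> x = (\<Inter>t\<in>{0..}. closure (flow_image \<phi> {x} {..-t}))"

definition J_plus :: "('a::topological_space \<Rightarrow> real \<Rightarrow> 'a) \<Rightarrow> 'a \<Rightarrow> 'a set" where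
  "J_plus \<phi> x = (\<Inter>U\<in>{U. open U \<and> x \<in> U}. \<Inter>t\<in>{0..}. closure (flow_image \<phi> U {t..}))"

definition J_minus :: "('a::topological_space \<Rightarrow> real \<Rightarrow> 'a) \<Rightarrow> 'a \<Rightarrow> 'a set" where
  "J_minus \<phi> x = (\<Inter>U\<in>{U. open U \<and> x \<in> U}. \<Inter>t\<in>{0..}. closure (flow_image \<phi> U {..-t}))"

definition isolated_invariant :: "('a::topological_space \<Rightarrow> real \<Rightarrow> 'a) \<Rightarrow> 'a set \<Rightarrow> bool" where
  "isolated_invariant \<phi> K \<longleftrightarrow>
     compact K \<and> invariant_set \<phi> K \<and>
     (\<exists>N. compact N \<and> K \<subseteq> interior N \<and> K = {x \<in> N. flow_image \<phi> {x} UNIV \<subseteq> N})"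

definition W_s :: "('a::topological_space \<Rightarrow> real \<Rightarrow> 'a) \<Rightarrow> 'a set \<Rightarrow> 'a set" where
  "W_s \<phi> K = {x. omega_limit \<phi> x \<noteq> {} \<and> omega_limit \<phi> x \<subseteq> K}"

definition W_u :: "('a::topological_space \<Rightarrow> real \<Rightarrow> 'a) \<Rightarrow> 'a set \<Rightarrow> 'a set" where
  "W_u \<phi> K = {x. alpha_limit \<phi> x \<noteq> {} \<and> alpha_limit \<phi> x \<subseteq> K}"

text \<open>Stability is deliberately not required.\<close>

definition isolated_attractor :: "('a::topological_space \<Rightarrow> real \<Rightarrow> 'a) \<Rightarrow> 'a set \<Rightarrow> bool" where
  "isolated_attractor \<phi> K \<longleftrightarrow> isolated_invariant \<phi> K \<and> K \<subseteq> interior (W_s \<phi> K)"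

abbreviation basin :: "('a::topological_space \<Rightarrow> real \<Rightarrow> 'a) \<Rightarrow> 'a set \<Rightarrow> 'a set" where
  "basin \<equiv> W_s"

definition stabilization :: "('a::topological_space \<Rightarrow> real \<Rightarrow> 'a) \<Rightarrow> 'a set \<Rightarrow> 'a set" where
  "stabilization \<phi> K = (\<Union>x\<in>K. J_plus \<phi> x)"

definition only_internal_explosions :: "('a::topological_space \<Rightarrow> real \<Rightarrow> 'a) \<Rightarrow> 'a set \<Rightarrow> bool" where
  "only_internal_explosions \<phi> K \<longleftrightarrow> (\<forall>x\<in>basin \<phi> K - K. J_plus \<phi> x \<subseteq> K)"

end

theory Submission
  imports Defs
begin

text \<open>The relation \<open>y \<in> J\<^sup>+(x)\<close> says that arbitrarily small neighbourhoods of \<open>x\<close> and \<open>y\<close> are joined by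
  arbitrarily long orbit segments; hence it is equivalent to \<open>x \<in> J\<^sup>-(y)\<close>. If \<open>x\<close> lies in the basin, an
  orbit starting near \<open>x\<close> first passes near some \<open>k \<in> K\<close>, so \<open>J\<^sup>+(x) \<subseteq> J\<^sup>+(k)\<close>, which with the
  duality gives (2) \<open>\<Longrightarrow>\<close> (1). For (1) \<open>\<Longrightarrow>\<close> (2) the issue is that \<open>J\<^sup>-(x)\<close> might leave the basin: then
  long orbit segments ending near \<open>x\<close> cross the frontier of a compact neighbourhood of the
  stabilization inside the basin, and an accumulation point \<open>w\<close> of the crossings either lies on the orbit
  of \<open>x\<close>, which is impossible as the stabilization is invariant, or has \<open>x \<in> J\<^sup>+(w) \<subseteq> K\<close>.\<close>

text \<open>Local compactness encloses each point of \<open>K\<close> in a compact piece of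
  \<open>A\<close>; finitely many pieces suffice. This serves both for \<open>K\<close> and for its
  stabilization inside the basin.\<close>

lemma compact_neighbourhood:
  fixes K A :: "'a::t2_space set"
  assumes lc: "locally compact (UNIV :: 'a set)" and K: "compact K" and A: "open A" "K \<subseteq> A"
  obtains N where "compact N" "K \<subseteq> interior N" "N \<subseteq> A"
proof -
  have "\<exists>U C. open U \<and> x \<in> U \<and> compact C \<and> U \<subseteq> C \<and> C \<subseteq> A" if "x \<in> K" for x
    by (rule locallyE[OF lc, of A x]) (use A that in auto)
  then obtain U C where UC: "\<And>x. x \<in> K \<Longrightarrow> open (U x) \<and> x \<in> U x \<and> compact (C x) \<and> U x \<subseteq> C x \<and> C x \<subseteq> A"
    by metis
  obtain F where F: "F \<subseteq> K" "finite F" "K \<subseteq> (\<Union>x\<in>F. U x)"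
    by (rule compactE_image[OF K, of K U]) (use UC in blast)+
  show ?thesis
  proof (rule that)
    show "compact (\<Union>x\<in>F. C x)"
      using F UC by (intro compact_UN) auto
    have "(\<Union>x\<in>F. U x) \<subseteq> interior (\<Union>x\<in>F. C x)"
      using F UC by (intro interior_maximal open_UN) blast+
    then show "K \<subseteq> interior (\<Union>x\<in>F. C x)"
      using F(3) by blast
    show "(\<Union>x\<in>F. C x) \<subseteq> A"
      using F(1) UC by blast
  qed
qed

section \<open>Continuity of the flow and compactness of flow images\<close>

locale flow =
  fixes \<phi> :: "'a::metric_space \<Rightarrow> real \<Rightarrow> 'a"
  assumes continuous_flow: "continuous_flow \<phi>"
begin

lemma flow_zero [simp]: "\<phi> x 0 = x"
  and flow_add: "\<phi> (\<phi> x s) t = \<phi> x (s + t)"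
  using continuous_flow by (auto simp: continuous_flow_def)

lemma continuous_on_flow:
  assumes "continuous_on S f" "continuous_on S g"
  shows "continuous_on S (\<lambda>z. \<phi> (f z) (g z))"
proof -
  have "continuous_on UNIV (\<lambda>(x, t). \<phi> x t)"
    using continuous_flow by (simp add: continuous_flow_def)
  from continuous_on_compose2[OF this continuous_on_Pair[OF assms]]
  show ?thesis by simp
qed

lemma open_flow_vimage: "open U \<Longrightarrow> open {x. \<phi> x s \<in> U}"
  using open_vimage[OF _ continuous_on_flow[OF continuous_on_id continuous_on_const], of U s]
  by (simp add: vimage_def)

lemma compact_flow_image:
  assumes "compact A" "compact T"
  shows "compact (flow_image \<phi> A T)"
proof -
  have "flow_image \<phi> A T = (\<lambda>z. \<phi> (fst z) (snd z)) ` (A \<times> T)"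
    by (force simp: flow_image_def)
  moreover have "continuous_on (A \<times> T) (\<lambda>z. \<phi> (fst z) (snd z))"
    by (intro continuous_on_flow continuous_intros)
  ultimately show ?thesis
    using assms by (simp add: compact_continuous_image compact_Times)
qed

lemma invariant_set_flow: "invariant_set \<phi> A \<Longrightarrow> x \<in> A \<Longrightarrow> \<phi> x s \<in> A"
  by (auto simp: invariant_set_def flow_image_def)

section \<open>Limit sets and prolongations in terms of neighbourhoods\<close>

lemma closure_flow_image_iff:
  "y \<in> closure (flow_image \<phi> A T) \<longleftrightarrow> (\<forall>V. open V \<longrightarrow> y \<in> V \<longrightarrow> (\<exists>u\<in>A. \<exists>s\<in>T. \<phi> u s \<in> V))"
  unfolding closure_iff_nhds_not_empty flow_image_def by blast

text \<open>Any real \<open>t\<close> is allowed, since the bound \<open>max t 0\<close> is stronger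
  than \<open>t\<close>. In this form the two points play the same role up to the direction of time,
  which prepares the duality.\<close>

lemma J_plus_iff:
  "y \<in> J_plus \<phi> x \<longleftrightarrow>
    (\<forall>U V t. open U \<longrightarrow> x \<in> U \<longrightarrow> open V \<longrightarrow> y \<in> V \<longrightarrow> (\<exists>u\<in>U. \<exists>s\<ge>t. \<phi> u s \<in> V))"
  (is "?L \<longleftrightarrow> ?R")
proof
  assume L: ?L
  show ?R
  proof (intro allI impI)
    fix U V t assume "open U" "x \<in> U" "open V" "y \<in> V"
    moreover from this L have "y \<in> closure (flow_image \<phi> U {max t 0..})"
      by (auto simp: J_plus_def)
    ultimately show "\<exists>u\<in>U. \<exists>s\<ge>t. \<phi> u s \<in> V"
      unfolding closure_flow_image_iff by (meson atLeast_iff max.boundedE)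
  qed
next
  assume ?R
  then show ?L
    unfolding J_plus_def INT_iff closure_flow_image_iff
    by (metis (no_types, lifting) atLeast_iff mem_Collect_eq)
qed

lemma J_minus_iff:
  "y \<in> J_minus \<phi> x \<longleftrightarrow>
    (\<forall>U V t. open U \<longrightarrow> x \<in> U \<longrightarrow> open V \<longrightarrow> y \<in> V \<longrightarrow> (\<exists>u\<in>U. \<exists>s\<ge>t. \<phi> u (- s) \<in> V))"
  (is "?L \<longleftrightarrow> ?R")
proof
  assume L: ?L
  show ?R
  proof (intro allI impI)
    fix U V t assume *: "open U" "x \<in> U" "open V" "y \<in> V"
    moreover from this L have "y \<in> closure (flow_image \<phi> U {..- max t 0})"
      by (auto simp: J_minus_def)
    ultimately obtain u s where "u \<in> U" "s \<le> - max t 0" "\<phi> u s \<in> V"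
      unfolding closure_flow_image_iff by (meson atMost_iff)
    then show "\<exists>u\<in>U. \<exists>s\<ge>t. \<phi> u (- s) \<in> V"
      by (intro bexI[of _ u] exI[of _ "- s"]) auto
  qed
next
  assume R: ?R
  show ?L
    unfolding J_minus_def INT_iff closure_flow_image_iff
  proof (intro ballI allI impI)
    fix U t V assume "U \<in> {U. open U \<and> x \<in> U}" "open V" "y \<in> V"
    with R obtain u s where "u \<in> U" "s \<ge> t" "\<phi> u (- s) \<in> V"
      by blast
    then show "\<exists>u\<in>U. \<exists>s\<in>{..- t}. \<phi> u s \<in> V"
      by (intro bexI[of _ u] bexI[of _ "- s"]) auto
  qed
qed

lemma omega_limit_iff:
  "y \<in> omega_limit \<phi> x \<longleftrightarrow> (\<forall>V t. open V \<longrightarrow> y \<in> V \<longrightarrow> (\<exists>s\<ge>t. \<phi> x s \<in> V))"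
  (is "?L \<longleftrightarrow> ?R")
proof
  assume L: ?L
  show ?R
  proof (intro allI impI)
    fix V t assume "open V" "y \<in> V"
    moreover from L have "y \<in> closure (flow_image \<phi> {x} {max t 0..})"
      by (auto simp: omega_limit_def)
    ultimately show "\<exists>s\<ge>t. \<phi> x s \<in> V"
      unfolding closure_flow_image_iff by (metis atLeast_iff max.boundedE singletonD)
  qed
next
  assume ?R
  then show ?L
    unfolding omega_limit_def INT_iff closure_flow_image_iff by (metis atLeast_iff insertI1)
qed

section \<open>Duality of prolongations and their behaviour along orbits\<close>

lemma J_minus_iff_J_plus: "y \<in> J_minus \<phi> x \<longleftrightarrow> x \<in> J_plus \<phi> y"
proof
  assume L: "y \<in> J_minus \<phi> x"
  show "x \<in> J_plus \<phi> y"
    unfolding J_plus_iff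
  proof (intro allI impI)
    fix U V t assume "open U" "y \<in> U" "open V" "x \<in> V"
    with L obtain u s where "u \<in> V" "s \<ge> t" "\<phi> u (- s) \<in> U"
      unfolding J_minus_iff by blast
    \<comment> \<open>The far end of the backward segment becomes the starting point of the forward
      one.\<close>
    then show "\<exists>u\<in>U. \<exists>s\<ge>t. \<phi> u s \<in> V"
      by (intro bexI[of _ "\<phi> u (- s)"] exI[of _ s]) (auto simp: flow_add)
  qed
next
  assume L: "x \<in> J_plus \<phi> y"
  show "y \<in> J_minus \<phi> x"
    unfolding J_minus_iff
  proof (intro allI impI)
    fix U V t assume "open U" "x \<in> U" "open V" "y \<in> V"
    with L obtain u s where "u \<in> V" "s \<ge> t" "\<phi> u s \<in> U"
      unfolding J_plus_iff by blast
    then show "\<exists>u\<in>U. \<exists>s\<ge>t. \<phi> u (- s) \<in> V"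
      by (intro bexI[of _ "\<phi> u s"] exI[of _ s]) (auto simp: flow_add)
  qed
qed

text \<open>Moving the base point along its orbit changes only the elapsed time: pull
  \<open>U\<close> back by the time-\<open>r\<close> map and ask for a time at least
  \<open>t + r\<close>. With \<open>r = 0\<close> this is the elimination form of
  \<open>J_plus_iff\<close>.\<close>

lemma J_plus_orbit_reaches:
  assumes y: "y \<in> J_plus \<phi> x" and U: "open U" "\<phi> x r \<in> U" and V: "open V" "y \<in> V"
  shows "\<exists>u\<in>U. \<exists>s\<ge>t. \<phi> u s \<in> V"
proof -
  obtain u s where "\<phi> u r \<in> U" "s \<ge> t + r" "\<phi> u s \<in> V"
    using y open_flow_vimage[OF U(1), of r] U(2) V unfolding J_plus_iff
    by (metis (no_types, lifting) mem_Collect_eq)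
  then show ?thesis
    by (intro bexI[of _ "\<phi> u r"] exI[of _ "s - r"]) (auto simp: flow_add)
qed

lemma J_plus_flow:
  assumes "y \<in> J_plus \<phi> x"
  shows "\<phi> y r \<in> J_plus \<phi> x"
  unfolding J_plus_iff
proof (intro allI impI)
  fix U V t assume "open U" "x \<in> U" "open V" "\<phi> y r \<in> V"
  then obtain u s where "u \<in> U" "s \<ge> t - r" "\<phi> (\<phi> u s) r \<in> V"
    using assms open_flow_vimage[of V r] unfolding J_plus_iff
    by (metis (no_types, lifting) mem_Collect_eq)
  then show "\<exists>u\<in>U. \<exists>s\<ge>t. \<phi> u s \<in> V"
    by (intro bexI[of _ u] exI[of _ "s + r"]) (auto simp: flow_add)
qed

lemma J_plus_subset_omega_limit:
  assumes "k \<in> omega_limit \<phi> x"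
  shows "J_plus \<phi> x \<subseteq> J_plus \<phi> k"
proof
  fix y assume y: "y \<in> J_plus \<phi> x"
  show "y \<in> J_plus \<phi> k"
    unfolding J_plus_iff
  proof (intro allI impI)
    fix U V t assume UV: "open U" "k \<in> U" "open V" "y \<in> V"
    then obtain r where "\<phi> x r \<in> U"
      using assms unfolding omega_limit_iff by blast
    with y UV show "\<exists>u\<in>U. \<exists>s\<ge>t. \<phi> u s \<in> V"
      by (intro J_plus_orbit_reaches)
  qed
qed

lemma omega_limit_flow: "omega_limit \<phi> (\<phi> x r) = omega_limit \<phi> x"
proof -
  \<comment> \<open>Stated for all \<open>x\<close> and \<open>r\<close>, so that flowing back by
    \<open>- r\<close> gives the reverse inclusion.\<close>
  have *: "omega_limit \<phi> x \<subseteq> omega_limit \<phi> (\<phi> x r)" for x r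
  proof
    fix y assume y: "y \<in> omega_limit \<phi> x"
    show "y \<in> omega_limit \<phi> (\<phi> x r)"
      unfolding omega_limit_iff
    proof (intro allI impI)
      fix V t assume "open V" "y \<in> V"
      with y obtain s where "s \<ge> t + r" "\<phi> x s \<in> V"
        unfolding omega_limit_iff by blast
      then show "\<exists>s\<ge>t. \<phi> (\<phi> x r) s \<in> V"
        by (intro exI[of _ "s - r"]) (auto simp: flow_add)
    qed
  qed
  show ?thesis
    using *[of x r] *[of "\<phi> x r" "- r"] by (simp add: flow_add)
qed

section \<open>The basin and a compact set absorbing its forward prolongations\<close>

lemma W_s_flow_iff: "\<phi> x r \<in> W_s \<phi> K \<longleftrightarrow> x \<in> W_s \<phi> K"
  by (simp add: W_s_def omega_limit_flow)

text \<open>Here the nonemptiness demanded in \<open>W_s\<close> enters: some limit point inside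
  \<open>K\<close> must exist to bring the orbit into \<open>U\<close> at late times.\<close>

lemma W_s_orbit_reaches:
  assumes "x \<in> W_s \<phi> K" "open U" "K \<subseteq> U"
  obtains s where "s \<ge> t" "\<phi> x s \<in> U"
proof -
  obtain k where "k \<in> omega_limit \<phi> x" "k \<in> U"
    using assms unfolding W_s_def by blast
  then show ?thesis
    using that assms(2) unfolding omega_limit_iff by blast
qed

text \<open>The orbit of a basin point enters the interior of the basin at some time
  \<open>s\<close>. The preimage of that interior under the time-\<open>s\<close> map is open and
  stays in the basin by flow invariance.\<close>

lemma open_W_s:
  assumes "K \<subseteq> interior (W_s \<phi> K)"
  shows "open (W_s \<phi> K)"
  unfolding open_subopen[of "W_s \<phi> K"]
proof
  fix x assume "x \<in> W_s \<phi> K"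
  then obtain s where "\<phi> x s \<in> interior (W_s \<phi> K)"
    using W_s_orbit_reaches[OF _ open_interior assms] by blast
  moreover have "{z. \<phi> z s \<in> interior (W_s \<phi> K)} \<subseteq> W_s \<phi> K"
    using interior_subset W_s_flow_iff by blast
  ultimately show "\<exists>T. open T \<and> x \<in> T \<and> T \<subseteq> W_s \<phi> K"
    by (intro exI[of _ "{z. \<phi> z s \<in> interior (W_s \<phi> K)}"]) (simp add: open_flow_vimage)
qed

text \<open>By compactness the return times are bounded by some \<open>T\<close>; they are at least 1, so at any time \<open>s\<close> the
  last visit to \<open>N\<close> before \<open>s\<close> happened less than \<open>T\<close> ago.\<close>

lemma compact_forward_orbit:
  assumes N: "compact N" and return: "\<And>x. x \<in> N \<Longrightarrow> \<exists>s\<ge>1. \<phi> x s \<in> interior N"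
  obtains T where "flow_image \<phi> N {0..} \<subseteq> flow_image \<phi> N {0..T}"
proof -
  obtain \<tau> where \<tau>: "\<And>x. x \<in> N \<Longrightarrow> 1 \<le> \<tau> x \<and> \<phi> x (\<tau> x) \<in> interior N"
    using return by metis
  obtain F where F: "F \<subseteq> N" "finite F" "N \<subseteq> (\<Union>x\<in>F. {z. \<phi> z (\<tau> x) \<in> interior N})"
    by (rule compactE_image[OF N, of N "\<lambda>x. {z. \<phi> z (\<tau> x) \<in> interior N}"])
      (use \<tau> open_flow_vimage[OF open_interior] in blast)+
  \<comment> \<open>If \<open>F\<close> is empty, so is \<open>N\<close>, and the unspecified value
    of \<open>Max\<close> on the empty set is harmless.\<close>
  define T where "T = Max (\<tau> ` F)"
  have T: "\<tau> x \<le> T" if "x \<in> F" for x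
    using F(2) that by (simp add: T_def)
  have "\<phi> x s \<in> flow_image \<phi> N {0..T}" if x: "x \<in> N" and "s \<ge> 0" for x s
  proof -
    let ?R = "{r \<in> {0..s}. \<phi> x r \<in> N}"
    have "compact ?R"
    proof -
      have "closed ((\<lambda>r. \<phi> x r) -` N)"
        by (intro closed_vimage compact_imp_closed N continuous_on_flow continuous_intros)
      moreover have "?R = {0..s} \<inter> (\<lambda>r. \<phi> x r) -` N" by auto
      ultimately show ?thesis by (simp add: compact_Int_closed)
    qed
    moreover have "0 \<in> ?R" using that by simp
    ultimately obtain r where r: "r \<in> ?R" and last: "\<And>r'. r' \<in> ?R \<Longrightarrow> r' \<le> r"
      using compact_attains_sup[of ?R] by blast
    then obtain p where p: "p \<in> F" "\<phi> (\<phi> x r) (\<tau> p) \<in> interior N"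
      using F(3) by blast
    have "\<phi> x (r + \<tau> p) \<in> N" "1 \<le> \<tau> p" "\<tau> p \<le> T"
      using p interior_subset \<tau> F(1) T by (auto simp: flow_add)
    \<comment> \<open>\<open>r + \<tau> p\<close> is a visit strictly later than the last one up to
      time \<open>s\<close>, so it exceeds \<open>s\<close>.\<close>
    then have "s - r \<le> T"
      using last[of "r + \<tau> p"] r by fastforce
    moreover have "\<phi> x s = \<phi> (\<phi> x r) (s - r)"
      by (simp add: flow_add)
    ultimately show ?thesis
      using r unfolding flow_image_def by force
  qed
  then show ?thesis
    by (intro that) (auto simp: flow_image_def)
qed

text \<open>Take a compact neighbourhood \<open>N\<close> of \<open>K\<close> in the basin. Basin
  orbits enter its interior, and everything reached from there lies in the compact set
  \<open>flow_image \<phi> N {0..T}\<close>, which therefore contains the limits as well.\<close>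

lemma compact_attracting_neighbourhood:
  assumes "locally compact (UNIV :: 'a set)" "compact K" "K \<subseteq> interior (W_s \<phi> K)"
  obtains Q where "compact Q" "Q \<subseteq> W_s \<phi> K" "\<And>x. x \<in> W_s \<phi> K \<Longrightarrow> J_plus \<phi> x \<subseteq> Q"
proof -
  obtain N where N: "compact N" "K \<subseteq> interior N" "N \<subseteq> W_s \<phi> K"
    using compact_neighbourhood[OF assms(1,2) open_W_s[OF assms(3)]] assms(3) interior_subset
    by (metis order_trans)
  have "\<exists>s\<ge>1. \<phi> x s \<in> interior N" if "x \<in> N" for x
    using that N W_s_orbit_reaches[OF _ open_interior N(2)] by blast
  then obtain T where T: "flow_image \<phi> N {0..} \<subseteq> flow_image \<phi> N {0..T}"
    using compact_forward_orbit N(1) by blast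
  have cpt: "compact (flow_image \<phi> N {0..T})"
    by (intro compact_flow_image N compact_Icc)
  have "J_plus \<phi> x \<subseteq> flow_image \<phi> N {0..T}" if x: "x \<in> W_s \<phi> K" for x
  proof
    fix y assume y: "y \<in> J_plus \<phi> x"
    obtain r where "\<phi> x r \<in> interior N"
      using W_s_orbit_reaches[OF x open_interior N(2)] by blast
    with y have "y \<in> closure (flow_image \<phi> (interior N) {0..})"
      unfolding closure_flow_image_iff using J_plus_orbit_reaches[OF _ open_interior]
      by (metis atLeast_iff)
    also have "\<dots> \<subseteq> flow_image \<phi> N {0..T}"
    proof (intro closure_minimal compact_imp_closed cpt)
      show "flow_image \<phi> (interior N) {0..} \<subseteq> flow_image \<phi> N {0..T}"
        using T interior_subset unfolding flow_image_def by blast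
    qed
    finally show "y \<in> flow_image \<phi> N {0..T}" .
  qed
  moreover have "flow_image \<phi> N {0..T} \<subseteq> W_s \<phi> K"
    using N(3) by (auto simp: flow_image_def W_s_flow_iff)
  ultimately show ?thesis
    using that cpt by blast
qed

section \<open>Uniform avoidance over compact sets, and closedness of the stabilization\<close>

lemma compact_avoids_J_plus:
  assumes S: "compact S" and avoid: "\<And>w. w \<in> S \<Longrightarrow> x \<notin> J_plus \<phi> w"
  obtains U V t where "open U" "S \<subseteq> U" "open V" "x \<in> V" "\<And>u s. u \<in> U \<Longrightarrow> s \<ge> t \<Longrightarrow> \<phi> u s \<notin> V"
proof -
  have "\<exists>U V t. open U \<and> w \<in> U \<and> open V \<and> x \<in> V \<and> (\<forall>u\<in>U. \<forall>s\<ge>t. \<phi> u s \<notin> V)" if "w \<in> S" for w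
    using avoid[OF that] unfolding J_plus_iff by simp
  then obtain U V t where UV: "\<And>w. w \<in> S \<Longrightarrow> open (U w) \<and> w \<in> U w \<and> open (V w) \<and> x \<in> V w"
    and far: "\<And>w u s. w \<in> S \<Longrightarrow> u \<in> U w \<Longrightarrow> s \<ge> t w \<Longrightarrow> \<phi> u s \<notin> V w"
    by metis
  obtain F where F: "F \<subseteq> S" "finite F" "S \<subseteq> (\<Union>w\<in>F. U w)"
    by (rule compactE_image[OF S, of S U]) (use UV in blast)+
  \<comment> \<open>One witness for all of \<open>S\<close>: the union of the sources, the finite
    intersection of the targets and the largest waiting time. For empty \<open>F\<close> the value
    of \<open>T\<close> is irrelevant.\<close>
  define T where "T = Max (t ` F)"
  have T: "t w \<le> T" if "w \<in> F" for w
    using F(2) that by (simp add: T_def)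
  show ?thesis
  proof (rule that)
    show "open (\<Union>w\<in>F. U w)" "open (\<Inter>w\<in>F. V w)" "x \<in> (\<Inter>w\<in>F. V w)"
      using UV F by (blast intro: open_UN open_INT)+
    show "\<phi> u s \<notin> (\<Inter>w\<in>F. V w)" if u: "u \<in> (\<Union>w\<in>F. U w)" and s: "s \<ge> T" for u s
    proof -
      obtain w where w: "w \<in> F" "u \<in> U w"
        using u by blast
      moreover have "s \<ge> t w"
        using T[OF w(1)] s by linarith
      ultimately show ?thesis
        using far F(1) by blast
    qed
  qed (fact F(3))
qed

lemma closed_stabilization:
  assumes "compact K"
  shows "closed (stabilization \<phi> K)"
  unfolding closed_def open_subopen[of "- stabilization \<phi> K"]
proof
  fix y assume "y \<in> - stabilization \<phi> K"
  then have "\<And>k. k \<in> K \<Longrightarrow> y \<notin> J_plus \<phi> k"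
    by (auto simp: stabilization_def)
  then obtain U V t where UV: "open U" "K \<subseteq> U" "open V" "y \<in> V"
    and far: "\<And>u s. u \<in> U \<Longrightarrow> s \<ge> t \<Longrightarrow> \<phi> u s \<notin> V"
    using compact_avoids_J_plus[OF assms] by metis
  \<comment> \<open>The target \<open>V\<close> was chosen uniformly over \<open>K\<close>, so it
    excludes all its points from every \<open>J_plus \<phi> k\<close> at once.\<close>
  have "V \<subseteq> - stabilization \<phi> K"
  proof
    fix z assume z: "z \<in> V"
    have "z \<notin> J_plus \<phi> k" if "k \<in> K" for k
      using J_plus_orbit_reaches[of z k U 0 V t] z that UV far by auto
    then show "z \<in> - stabilization \<phi> K"
      by (simp add: stabilization_def)
  qed
  with UV show "\<exists>T. open T \<and> y \<in> T \<and> T \<subseteq> - stabilization \<phi> K"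
    by blast
qed

lemma stabilization_flow: "x \<in> stabilization \<phi> K \<Longrightarrow> \<phi> x r \<in> stabilization \<phi> K"
  using J_plus_flow by (auto simp: stabilization_def)

lemma J_plus_subset_stabilization: "x \<in> W_s \<phi> K \<Longrightarrow> J_plus \<phi> x \<subseteq> stabilization \<phi> K"
  using J_plus_subset_omega_limit unfolding W_s_def stabilization_def by fast

section \<open>Backward limit sets and the unstable manifold\<close>

lemma alpha_limit_in_compact:
  assumes C: "compact C" and x: "\<And>s. \<phi> x s \<in> C"
  shows "alpha_limit \<phi> x \<noteq> {}" "alpha_limit \<phi> x \<subseteq> C"
proof -
  have "closure (flow_image \<phi> {x} {..-t}) \<subseteq> C" for t
    using x by (intro closure_minimal compact_imp_closed C) (auto simp: flow_image_def)
  then show "alpha_limit \<phi> x \<subseteq> C"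
    by (force simp: alpha_limit_def)
  have "C \<inter> (\<Inter>t\<in>{0..}. closure (flow_image \<phi> {x} {..-t})) \<noteq> {}"
  proof (rule compact_imp_fip_image[OF C])
    fix F :: "real set" assume F: "finite F" "F \<subseteq> {0..}"
    then obtain T where T: "\<And>t. t \<in> F \<Longrightarrow> t \<le> T"
      by (metis Max_ge)
    \<comment> \<open>The backward tails are nested, so one sufficiently early orbit point lies in
      all finitely many of them.\<close>
    have "\<phi> x (- T) \<in> closure (flow_image \<phi> {x} {..-t})" if "t \<in> F" for t
      using T[OF that] by (intro subsetD[OF closure_subset]) (auto simp: flow_image_def)
    then show "C \<inter> (\<Inter>t\<in>F. closure (flow_image \<phi> {x} {..-t})) \<noteq> {}"
      using x by blast
  qed auto
  then show "alpha_limit \<phi> x \<noteq> {}"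
    by (auto simp: alpha_limit_def)
qed

lemma alpha_limit_subset_J_minus: "alpha_limit \<phi> x \<subseteq> J_minus \<phi> x"
proof -
  have "closure (flow_image \<phi> {x} T) \<subseteq> closure (flow_image \<phi> U T)" if "x \<in> U" for U T
    using that by (intro closure_mono) (auto simp: flow_image_def)
  then show ?thesis
    unfolding alpha_limit_def J_minus_def by blast
qed

text \<open>A point \<open>k\<close> of the backward limit set lies in
  \<open>J_minus \<phi> x\<close>, so by duality \<open>x\<close> is in
  \<open>J_plus \<phi> k\<close>.\<close>

lemma W_u_subset_stabilization: "W_u \<phi> K \<subseteq> stabilization \<phi> K"
proof
  fix x assume "x \<in> W_u \<phi> K"
  then obtain k where "k \<in> alpha_limit \<phi> x" "k \<in> K"
    by (auto simp: W_u_def)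
  then show "x \<in> stabilization \<phi> K"
    using alpha_limit_subset_J_minus[of x] J_minus_iff_J_plus[of k x]
    unfolding stabilization_def by blast
qed

text \<open>Combined with the preceding inclusion, this places \<open>K\<close> inside its
  stabilization.\<close>

lemma invariant_subset_W_u:
  assumes "compact K" "invariant_set \<phi> K"
  shows "K \<subseteq> W_u \<phi> K"
  using alpha_limit_in_compact[OF assms(1)] invariant_set_flow[OF assms(2)] by (auto simp: W_u_def)

lemma stabilization_eq_W_u:
  assumes K: "compact K" "invariant_set \<phi> K" and cpt: "compact (stabilization \<phi> K)"
    and J: "\<And>x. x \<in> stabilization \<phi> K - K \<Longrightarrow> J_minus \<phi> x \<subseteq> K"
  shows "stabilization \<phi> K = W_u \<phi> K"
proof (intro equalityI W_u_subset_stabilization subsetI)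
  fix x assume x: "x \<in> stabilization \<phi> K"
  show "x \<in> W_u \<phi> K"
  proof (cases "x \<in> K")
    case True
    then show ?thesis
      using invariant_subset_W_u[OF K] by blast
  next
    case False
    then have "alpha_limit \<phi> x \<subseteq> K"
      using alpha_limit_subset_J_minus J x by blast
    \<comment> \<open>Nonemptiness comes from the compact invariant stabilization, which contains
      the whole orbit.\<close>
    then show ?thesis
      using alpha_limit_in_compact(1)[OF cpt] stabilization_flow[OF x] by (simp add: W_u_def)
  qed
qed

section \<open>Backward prolongations stay in the basin\<close>

lemma J_minus_subset_basin:
  assumes lc: "locally compact (UNIV :: 'a set)"
    and cpt: "compact (stabilization \<phi> K)" "stabilization \<phi> K \<subseteq> W_s \<phi> K" and op: "open (W_s \<phi> K)"
    and explosions: "only_internal_explosions \<phi> K"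
    and K: "K \<subseteq> stabilization \<phi> K"
    and x: "x \<in> stabilization \<phi> K" "x \<notin> K"
  shows "J_minus \<phi> x \<subseteq> W_s \<phi> K"
proof
  fix y assume "y \<in> J_minus \<phi> x"
  then have y: "x \<in> J_plus \<phi> y"
    by (simp add: J_minus_iff_J_plus)
  obtain B where B: "compact B" "stabilization \<phi> K \<subseteq> interior B" "B \<subseteq> W_s \<phi> K"
    using compact_neighbourhood[OF lc cpt(1) op cpt(2)] by metis
  have frontier: "compact (frontier B)" "frontier B \<subseteq> W_s \<phi> K - stabilization \<phi> K"
    using B compact_imp_closed[OF B(1)] compact_Int_closed[OF B(1), of "frontier B"]
    by (auto simp: frontier_def Int_absorb1 compact_diff)
  \<comment> \<open>Frontier points lie in the basin but outside \<open>K\<close>, so their forward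
    prolongations lie in \<open>K\<close>, which misses \<open>x\<close>.\<close>
  have "x \<notin> J_plus \<phi> w" if "w \<in> frontier B" for w
    using that explosions frontier(2) K x(2) unfolding only_internal_explosions_def by blast
  then obtain U V t where V: "open V" "x \<in> V" "frontier B \<subseteq> U"
    and far: "\<And>u s. u \<in> U \<Longrightarrow> s \<ge> t \<Longrightarrow> \<phi> u s \<notin> V"
    using compact_avoids_J_plus[OF frontier(1)] by metis
  \<comment> \<open>A neighbourhood of \<open>x\<close> unreachable from the frontier:
    \<open>V\<close> rules out times from \<open>t\<close> on, the removed compact set rules out
    times up to \<open>t\<close>. The factor \<open>interior B\<close> puts segments ending in
    \<open>V'\<close> inside \<open>B\<close> at their end.\<close>
  define V' where "V' = V \<inter> interior B - flow_image \<phi> (frontier B) {0..t}"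
  have "x \<notin> flow_image \<phi> (frontier B) {0..t}"
  proof
    assume "x \<in> flow_image \<phi> (frontier B) {0..t}"
    then obtain w s where "w \<in> frontier B" "x = \<phi> w s"
      by (auto simp: flow_image_def)
    then show False
      using stabilization_flow[OF x(1), of "- s"] frontier(2) by (auto simp: flow_add)
  qed
  then have V': "open V'" "x \<in> V'"
    using V B(2) x(1) compact_imp_closed[OF compact_flow_image[OF frontier(1) compact_Icc]]
    by (auto simp: V'_def intro!: open_Diff)
  have avoid: "\<phi> w s \<notin> V'" if "w \<in> frontier B" "s \<ge> 0" for w s
  proof (cases "s \<ge> t")
    case True
    then show ?thesis
      using that(1) far[of w s] V(3) by (auto simp: V'_def)
  next
    case False
    then have "\<phi> w s \<in> flow_image \<phi> (frontier B) {0..t}"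
      using that by (force simp: flow_image_def)
    then show ?thesis
      by (simp add: V'_def)
  qed
  show "y \<in> W_s \<phi> K"
  proof (rule ccontr)
    assume "y \<notin> W_s \<phi> K"
    then have "open (- B)" "y \<in> - B"
      using B compact_imp_closed by auto
    then obtain u s where u: "u \<notin> B" "s \<ge> 0" "\<phi> u s \<in> V'"
      using J_plus_orbit_reaches[OF y, of "- B" 0 V' 0] V' by auto
    \<comment> \<open>The segment starts outside \<open>B\<close> and ends inside, so it crosses the
      frontier at some time \<open>r\<close>; the remaining time \<open>s - r\<close> contradicts
      \<open>avoid\<close>.\<close>
    have "connected (\<phi> u ` {0..s})"
      by (intro connected_continuous_image continuous_on_flow continuous_intros) simp
    moreover have "\<phi> u s \<in> \<phi> u ` {0..s} \<inter> B"
      using u(2,3) interior_subset[of B] by (auto simp: V'_def)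
    moreover have "\<phi> u 0 \<in> \<phi> u ` {0..s} - B"
      using u(1,2) by (intro DiffI imageI) auto
    ultimately have "\<phi> u ` {0..s} \<inter> frontier B \<noteq> {}"
      by (intro connected_Int_frontier) blast+
    then obtain r where "0 \<le> r" "r \<le> s" "\<phi> u r \<in> frontier B"
      by auto
    then show False
      using avoid[of "\<phi> u r" "s - r"] u(3) by (simp add: flow_add)
  qed
qed

end

section \<open>The equivalence and the unstable manifold\<close>

theorem proposition3:
  fixes \<phi> :: "'a::metric_space \<Rightarrow> real \<Rightarrow> 'a" and K :: "'a set"
  assumes "locally compact (UNIV :: 'a set)"
    and "continuous_flow \<phi>"
    and "isolated_attractor \<phi> K"
  shows "(only_internal_explosions \<phi> K \<longleftrightarrow>
            (\<forall>x\<in>stabilization \<phi> K - K. J_minus \<phi> x \<subseteq> K)) \<and>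
         (only_internal_explosions \<phi> K \<or>
            (\<forall>x\<in>stabilization \<phi> K - K. J_minus \<phi> x \<subseteq> K) \<longrightarrow>
          stabilization \<phi> K = W_u \<phi> K)"
proof -
  interpret flow \<phi>
    by standard fact
  have K: "compact K" "invariant_set \<phi> K" and nbhd: "K \<subseteq> interior (W_s \<phi> K)"
    using assms(3) by (auto simp: isolated_attractor_def isolated_invariant_def)
  have K_basin: "K \<subseteq> W_s \<phi> K"
    using nbhd interior_subset by blast
  have K_stab: "K \<subseteq> stabilization \<phi> K"
    using invariant_subset_W_u[OF K] W_u_subset_stabilization by blast
  obtain Q where Q: "compact Q" "Q \<subseteq> W_s \<phi> K" "\<And>x. x \<in> W_s \<phi> K \<Longrightarrow> J_plus \<phi> x \<subseteq> Q"
    using compact_attracting_neighbourhood[OF assms(1) K(1) nbhd] by metis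
  have "stabilization \<phi> K \<subseteq> Q"
    using Q(3) K_basin by (auto simp: stabilization_def)
  then have cpt: "compact (stabilization \<phi> K)" and stab_basin: "stabilization \<phi> K \<subseteq> W_s \<phi> K"
    using compact_Int_closed[OF Q(1) closed_stabilization[OF K(1)]] Q(2)
    by (auto simp: Int_absorb1)
  have equiv: "only_internal_explosions \<phi> K \<longleftrightarrow>
      (\<forall>x\<in>stabilization \<phi> K - K. J_minus \<phi> x \<subseteq> K)"
  proof
    assume explosions: "only_internal_explosions \<phi> K"
    show "\<forall>x\<in>stabilization \<phi> K - K. J_minus \<phi> x \<subseteq> K"
    proof (intro ballI subsetI)
      fix x y assume x: "x \<in> stabilization \<phi> K - K" and y: "y \<in> J_minus \<phi> x"
      then have "y \<in> W_s \<phi> K"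
        using J_minus_subset_basin[OF assms(1) cpt stab_basin open_W_s[OF nbhd] explosions K_stab] by blast
      moreover have "x \<in> J_plus \<phi> y"
        using y by (simp add: J_minus_iff_J_plus)
      \<comment> \<open>Otherwise \<open>y\<close> is a basin point outside \<open>K\<close>, and
        its forward prolongation carries \<open>x\<close> into \<open>K\<close>.\<close>
      ultimately show "y \<in> K"
        using x explosions unfolding only_internal_explosions_def by blast
    qed
  next
    assume J: "\<forall>x\<in>stabilization \<phi> K - K. J_minus \<phi> x \<subseteq> K"
    show "only_internal_explosions \<phi> K"
      unfolding only_internal_explosions_def
    proof (intro ballI subsetI)
      fix x y assume x: "x \<in> W_s \<phi> K - K" and y: "y \<in> J_plus \<phi> x"
      then have "y \<in> stabilization \<phi> K" "x \<in> J_minus \<phi> y"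
        using J_plus_subset_stabilization by (auto simp: J_minus_iff_J_plus)
      \<comment> \<open>Otherwise (2) applies to \<open>y\<close> and forces \<open>x\<close> into
        \<open>K\<close>.\<close>
      then show "y \<in> K"
        using x J by blast
    qed
  qed
  moreover have "stabilization \<phi> K = W_u \<phi> K"
    if "\<forall>x\<in>stabilization \<phi> K - K. J_minus \<phi> x \<subseteq> K"
    using stabilization_eq_W_u[OF K cpt] that by blast
  ultimately show ?thesis
    by blast
qed

end
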